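(* Let $(G,H)$ be a skew bracoid that is almost classical with respect to $H$, and let $S=\mathrm{Stab}_G(e)$, so that $G=HS\cong H\rtimes S$. There is a solution to the set-theoretic Yang-Baxter equation on $G$ given by $$\boldsymbol r(h_1s_1,h_2s_2)=\big(s_1h_2s_1^{-1},\ s_1h_2^{-1}s_1^{-1}h_1s_1h_2s_2\big)$$ for all $h_1,h_2\in H$ and all $s_1,s_2\in S$.
   Context: A skew bracoid $(G,\cdot,N,\star,\odot)$ consists of two groups $(G,\cdot)$ and $(N,\star)$ and a transitive action $\odot$ of $G$ on the set $N$ such that $g\odot(\eta_1\star\eta_2)=(g\odot\eta_1)\star(g\odot e_N)^{-1}\star(g\odot\eta_2)$ for all $g\in G$, $\eta_1,\eta_2\in N$. It is almost classical with respect to $H$ if $H$ is a normal subgroup of $G$ with $G=HS$ and $H\cap S$ trivial, where $S=\mathrm{Stab}_G(e_N)$, and $(h_1\odot e_N)\star(h_2\odot e_N)=h_1h_2\odot e_N$ for all $h_1,h_2\in H$. The notation $(G,H)$: if $H\le G$ is a complement to $S$, then $h\mapsto h\odot e_N$ is a bijection $H\to N$; transferring the additive group structure and the action from $N$ to $H$ along it gives a skew bracoid $(G,H)$ whose additive group has underlying set $H\subseteq G$ and identity $e=e_G$, with $h\odot e=h$ for $h\in H$. A solution to the set-theoretic Yang-Baxter equation on a set $Y$ is a map $\boldsymbol r:Y\times Y\to Y\times Y$ with $(\boldsymbol r\times\mathrm{id})(\mathrm{id}\times\boldsymbol r)(\boldsymbol r\times\mathrm{id})=(\mathrm{id}\times\boldsymbol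 r)(\boldsymbol r\times\mathrm{id})(\mathrm{id}\times\boldsymbol r)$ as maps on $Y\times Y\times Y$. Products and inverses in the displayed formula are in $(G,\cdot)$. *)

theory Defs
  imports "HOL-Algebra.Algebra"
begin

section \<open>Skew bracoids\<close>

locale skew_bracoid =
  transitive_action G "carrier N" act + N: group N
  for G (structure) and N (structure) and act +
  assumes act_mult:
    "\<lbrakk>g \<in> carrier G; x \<in> carrier N; y \<in> carrier N\<rbrakk> \<Longrightarrow>
      act g (x \<otimes>\<^bsub>N\<^esub> y) =
        act g x \<otimes>\<^bsub>N\<^esub> inv\<^bsub>N\<^esub> (act g \<one>\<^bsub>N\<^esub>) \<otimes>\<^bsub>N\<^esub> act g y"

abbreviation bracoid_stab ::
  "('a, 'm) monoid_scheme \<Rightarrow> ('b, 'n) monoid_scheme \<Rightarrow> ('a \<Rightarrow> 'b \<Rightarrow> 'b) \<Rightarrow> 'a set"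
  where "bracoid_stab G N act \<equiv> stabilizer G act \<one>\<^bsub>N\<^esub>"

definition is_complement :: "('a, 'm) monoid_scheme \<Rightarrow> 'a set \<Rightarrow> 'a set \<Rightarrow> bool"
  where "is_complement G H S \<longleftrightarrow>
    subgroup H G \<and> H <#>\<^bsub>G\<^esub> S = carrier G \<and> H \<inter> S = {\<one>\<^bsub>G\<^esub>}"

locale almost_classical = skew_bracoid G N act + normal H G
  for G (structure) and N (structure) and act and H +
  assumes complement: "is_complement G H (bracoid_stab G N act)"
    and act_one_hom:
      "\<lbrakk>h1 \<in> H; h2 \<in> H\<rbrakk> \<Longrightarrow>
        act h1 \<one>\<^bsub>N\<^esub> \<otimes>\<^bsub>N\<^esub> act h2 \<one>\<^bsub>N\<^esub> = act (h1 \<otimes>\<^bsub>G\<^esub> h2) \<one>\<^bsub>N\<^esub>"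


section \<open>Transferring the additive group to a complement of the stabilizer\<close>

definition from_complement ::
  "('b, 'n) monoid_scheme \<Rightarrow> ('a \<Rightarrow> 'b \<Rightarrow> 'b) \<Rightarrow> 'a \<Rightarrow> 'b"
  where "from_complement N act h = act h \<one>\<^bsub>N\<^esub>"

definition to_complement ::
  "('b, 'n) monoid_scheme \<Rightarrow> ('a \<Rightarrow> 'b \<Rightarrow> 'b) \<Rightarrow> 'a set \<Rightarrow> 'b \<Rightarrow> 'a"
  where "to_complement N act H = inv_into H (from_complement N act)"

definition complement_group ::
  "('b, 'n) monoid_scheme \<Rightarrow> ('a \<Rightarrow> 'b \<Rightarrow> 'b) \<Rightarrow> 'a set \<Rightarrow> 'a monoid"
  where "complement_group N act H =
    \<lparr>carrier = H,
     monoid.mult = (\<lambda>x y. to_complement N act H (from_complement N act x \<otimes>\<^bsub>N\<^esub> from_complement N act y)),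
     one = to_complement N act H \<one>\<^bsub>N\<^esub>\<rparr>"

text \<open>Restricted to \<open>H\<close>, because the library's group actions are by extensional functions.\<close>

definition complement_act ::
  "('b, 'n) monoid_scheme \<Rightarrow> ('a \<Rightarrow> 'b \<Rightarrow> 'b) \<Rightarrow> 'a set \<Rightarrow> 'a \<Rightarrow> 'a \<Rightarrow> 'a"
  where "complement_act N act H g =
    (\<lambda>x\<in>H. to_complement N act H (act g (from_complement N act x)))"


text \<open>The transferred structure is the skew bracoid \<open>(G, H)\<close>, with the expected identity and
  with \<open>h\<close> mapping the identity to \<open>h\<close>.\<close>

lemma (in skew_bracoid)
  assumes "is_complement G H (bracoid_stab G N act)"
  shows bij_betw_from_complement: "bij_betw (from_complement N act) H (carrier N)"
    and one_complement_group: "\<one>\<^bsub>complement_group N act H\<^esub> = \<one>\<^bsub>G\<^esub>"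
    and complement_act_one: "h \<in> H \<Longrightarrow> complement_act N act H h \<one>\<^bsub>G\<^esub> = h"
    and skew_bracoid_complement:
      "skew_bracoid G (complement_group N act H) (complement_act N act H)"
proof -
  interpret G: group G
    using group_hom group_hom.axioms(1) by blast
  let ?p = "from_complement N act" and ?q = "to_complement N act H"
  let ?A = "complement_group N act H" and ?a = "complement_act N act H"
  from assms have sub: "subgroup H G" and HS: "H <#>\<^bsub>G\<^esub> bracoid_stab G N act = carrier G"
    and triv: "H \<inter> bracoid_stab G N act = {\<one>\<^bsub>G\<^esub>}"
    by (auto simp: is_complement_def)
  interpret H: subgroup H G by (fact sub)
  have a_one: "act \<one>\<^bsub>G\<^esub> x = x" if "x \<in> carrier N" for x
    using id_eq_one that by (metis restrict_apply')
  have a_cl: "act g x \<in> carrier N" if "g \<in> carrier G" "x \<in> carrier N" for g x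
    using element_image that by blast
  have a_mult: "act (g \<otimes>\<^bsub>G\<^esub> h) x = act g (act h x)"
    if "g \<in> carrier G" "h \<in> carrier G" "x \<in> carrier N" for g h x
    using composition_rule that by blast
  have p_cl: "?p h \<in> carrier N" if "h \<in> H" for h
    using that a_cl by (simp add: from_complement_def)
  show bij: "bij_betw ?p H (carrier N)"
    unfolding bij_betw_def
  proof
    show "inj_on ?p H"
    proof (rule inj_onI)
      fix x y assume xy: "x \<in> H" "y \<in> H" "?p x = ?p y"
      have "act (inv\<^bsub>G\<^esub> x \<otimes>\<^bsub>G\<^esub> y) \<one>\<^bsub>N\<^esub> = act (inv\<^bsub>G\<^esub> x) (act x \<one>\<^bsub>N\<^esub>)"
        using xy a_mult by (simp add: from_complement_def)
      also have "\<dots> = \<one>\<^bsub>N\<^esub>"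
        using xy a_mult[of "inv\<^bsub>G\<^esub> x" x "\<one>\<^bsub>N\<^esub>"] a_one by simp
      finally have "inv\<^bsub>G\<^esub> x \<otimes>\<^bsub>G\<^esub> y \<in> H \<inter> bracoid_stab G N act"
        using xy by (simp add: stabilizer_def)
      hence "inv\<^bsub>G\<^esub> x \<otimes>\<^bsub>G\<^esub> y = \<one>\<^bsub>G\<^esub>" using triv by blast
      thus "x = y"
        using xy by (metis G.inv_closed G.inv_equality G.inv_inv H.mem_carrier)
    qed
    show "?p ` H = carrier N"
    proof
      show "?p ` H \<subseteq> carrier N" using p_cl by blast
      show "carrier N \<subseteq> ?p ` H"
      proof
        fix n assume "n \<in> carrier N"
        then obtain g where g: "g \<in> carrier G" "act g \<one>\<^bsub>N\<^esub> = n"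
          using unique_orbit by blast
        obtain h s where hs: "h \<in> H" "s \<in> bracoid_stab G N act" "g = h \<otimes>\<^bsub>G\<^esub> s"
          using g(1) unfolding HS[symmetric] set_mult_def by blast
        hence "act g \<one>\<^bsub>N\<^esub> = ?p h"
          using a_mult[of h s "\<one>\<^bsub>N\<^esub>"] by (simp add: from_complement_def stabilizer_def)
        thus "n \<in> ?p ` H" using g hs by blast
      qed
    qed
  qed
  have q_cl: "?q n \<in> H" if "n \<in> carrier N" for n
    using bij that unfolding to_complement_def
    by (metis bij_betw_imp_surj_on inv_into_into)
  have pq: "?p (?q n) = n" if "n \<in> carrier N" for n
    using bij that unfolding to_complement_def by (metis bij_betw_inv_into_right)
  have qp: "?q (?p h) = h" if "h \<in> H" for h
    using bij that unfolding to_complement_def by (metis bij_betw_inv_into_left)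
  have p1: "?p \<one>\<^bsub>G\<^esub> = \<one>\<^bsub>N\<^esub>" by (simp add: from_complement_def a_one)
  show one: "\<one>\<^bsub>?A\<^esub> = \<one>\<^bsub>G\<^esub>"
    using qp[of "\<one>\<^bsub>G\<^esub>"] p1 by (simp add: complement_group_def)
  show "?a h \<one>\<^bsub>G\<^esub> = h" if "h \<in> H"
    using that qp p1 by (simp add: complement_act_def) (simp add: from_complement_def)
  have A_carr: "carrier ?A = H" by (simp add: complement_group_def)
  have A_mult: "x \<otimes>\<^bsub>?A\<^esub> y = ?q (?p x \<otimes>\<^bsub>N\<^esub> ?p y)" for x y
    by (simp add: complement_group_def)
  have pm: "?p (x \<otimes>\<^bsub>?A\<^esub> y) = ?p x \<otimes>\<^bsub>N\<^esub> ?p y" if "x \<in> H" "y \<in> H" for x y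
    using that pq p_cl by (simp add: A_mult)
  have A_group: "group ?A"
  proof (rule groupI)
    fix x assume x: "x \<in> carrier ?A"
    show "\<one>\<^bsub>?A\<^esub> \<otimes>\<^bsub>?A\<^esub> x = x"
      using x p1 qp p_cl by (simp add: A_carr A_mult one)
    have "?q (inv\<^bsub>N\<^esub> ?p x) \<otimes>\<^bsub>?A\<^esub> x = \<one>\<^bsub>?A\<^esub>"
      using x pq p_cl by (simp add: A_carr A_mult) (simp add: complement_group_def)
    thus "\<exists>y\<in>carrier ?A. y \<otimes>\<^bsub>?A\<^esub> x = \<one>\<^bsub>?A\<^esub>"
      using x q_cl p_cl A_carr by (metis N.inv_closed)
  qed (use q_cl p_cl pq in \<open>auto simp: A_carr A_mult one N.m_assoc\<close>)
  have p_inv: "?p (inv\<^bsub>?A\<^esub> x) = inv\<^bsub>N\<^esub> ?p x" if "x \<in> H" for x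
  proof -
    have "inv\<^bsub>?A\<^esub> x \<in> H" "inv\<^bsub>?A\<^esub> x \<otimes>\<^bsub>?A\<^esub> x = \<one>\<^bsub>?A\<^esub>"
      using that group.inv_closed[OF A_group] group.l_inv[OF A_group] A_carr by auto
    hence "?p (inv\<^bsub>?A\<^esub> x) \<otimes>\<^bsub>N\<^esub> ?p x = \<one>\<^bsub>N\<^esub>"
      using pm[of "inv\<^bsub>?A\<^esub> x" x] that p1 one by simp
    thus ?thesis using N.inv_equality p_cl \<open>inv\<^bsub>?A\<^esub> x \<in> H\<close> that by metis
  qed
  have a'_eq: "?a g x = ?q (act g (?p x))" if "x \<in> H" for g x
    using that by (simp add: complement_act_def)
  have a'_cl: "?a g x \<in> H" if "g \<in> carrier G" "x \<in> H" for g x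
    using that a_cl p_cl q_cl by (simp add: a'_eq)
  have p_a': "?p (?a g x) = act g (?p x)" if "g \<in> carrier G" "x \<in> H" for g x
    using that a_cl p_cl pq by (simp add: a'_eq)
  have a'_mult: "?a (g \<otimes>\<^bsub>G\<^esub> h) x = ?a g (?a h x)"
    if "g \<in> carrier G" "h \<in> carrier G" "x \<in> H" for g h x
    using that a_mult[of g h "?p x"] p_cl p_a' a'_cl by (simp add: a'_eq)
  have a'_one: "?a \<one>\<^bsub>G\<^esub> x = x" if "x \<in> H" for x
    using that a_one p_cl qp by (simp add: a'_eq)
  have a'_Bij: "?a g \<in> Bij H" if "g \<in> carrier G" for g
  proof -
    have "bij_betw (?a g) H H"
      by (rule bij_betw_byWitness[where f' = "?a (inv\<^bsub>G\<^esub> g)"])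
        (use that a'_mult[of g "inv\<^bsub>G\<^esub> g"] a'_mult[of "inv\<^bsub>G\<^esub> g" g] a'_one a'_cl in auto)
    thus ?thesis by (simp add: Bij_def complement_act_def)
  qed
  have hom: "?a \<in> hom G (BijGroup H)"
  proof (rule homI)
    show "?a g \<in> carrier (BijGroup H)" if "g \<in> carrier G" for g
      using a'_Bij that by (simp add: BijGroup_def)
    show "?a (g \<otimes>\<^bsub>G\<^esub> h) = ?a g \<otimes>\<^bsub>BijGroup H\<^esub> ?a h"
      if "g \<in> carrier G" "h \<in> carrier G" for g h
    proof -
      have "?a (g \<otimes>\<^bsub>G\<^esub> h) = compose H (?a g) (?a h)"
      proof
        fix x show "?a (g \<otimes>\<^bsub>G\<^esub> h) x = compose H (?a g) (?a h) x"
          using a'_mult[OF that] by (cases "x \<in> H") (auto simp: compose_def complement_act_def)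
      qed
      thus ?thesis using that a'_Bij by (simp add: BijGroup_def)
    qed
  qed
  show "skew_bracoid G ?A ?a"
  proof (intro skew_bracoid.intro transitive_action.intro group_action.intro
      transitive_action_axioms.intro skew_bracoid_axioms.intro A_group)
    show "group_hom G (BijGroup (carrier ?A)) ?a"
      unfolding A_carr group_hom_def group_hom_axioms_def
      using hom group_BijGroup G.group_axioms by blast
    fix x y assume "x \<in> carrier ?A" "y \<in> carrier ?A"
    hence xy: "x \<in> H" "y \<in> H" by (auto simp: A_carr)
    then obtain g where "g \<in> carrier G" "act g (?p x) = ?p y"
      using unique_orbit p_cl by metis
    thus "\<exists>g\<in>carrier G. ?a g x = y"
      using xy qp by (metis a'_eq)
  next
    fix g x y assume g: "g \<in> carrier G" and "x \<in> carrier ?A" "y \<in> carrier ?A"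
    hence xy: "x \<in> H" "y \<in> H" by (auto simp: A_carr)
    let ?r = "?a g x \<otimes>\<^bsub>?A\<^esub> inv\<^bsub>?A\<^esub> (?a g \<one>\<^bsub>?A\<^esub>) \<otimes>\<^bsub>?A\<^esub> ?a g y"
    have m_cl: "u \<otimes>\<^bsub>?A\<^esub> v \<in> H" if "u \<in> H" "v \<in> H" for u v
      using that q_cl p_cl by (simp add: A_mult)
    have i_cl: "inv\<^bsub>?A\<^esub> u \<in> H" if "u \<in> H" for u
      using that group.inv_closed[OF A_group] A_carr by auto
    have r_cl: "?r \<in> H" using g xy a'_cl m_cl i_cl one by simp
    have "?p ?r = act g (?p x) \<otimes>\<^bsub>N\<^esub> inv\<^bsub>N\<^esub> (act g \<one>\<^bsub>N\<^esub>) \<otimes>\<^bsub>N\<^esub> act g (?p y)"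
      using g xy a'_cl m_cl i_cl by (simp add: pm p_inv p_a' one p1)
    also have "\<dots> = ?p (?a g (x \<otimes>\<^bsub>?A\<^esub> y))"
      using g xy p_cl m_cl by (simp add: act_mult p_a' pm)
    finally show "?a g (x \<otimes>\<^bsub>?A\<^esub> y) = ?r"
      using qp r_cl a'_cl g m_cl xy by metis
  qed
qed


section \<open>Solutions of the set-theoretic Yang-Baxter equation\<close>

definition times_id :: "('a \<times> 'a \<Rightarrow> 'a \<times> 'a) \<Rightarrow> 'a \<times> 'a \<times> 'a \<Rightarrow> 'a \<times> 'a \<times> 'a"
  where "times_id r = (\<lambda>(x, y, z). (fst (r (x, y)), snd (r (x, y)), z))"

definition id_times :: "('a \<times> 'a \<Rightarrow> 'a \<times> 'a) \<Rightarrow> 'a \<times> 'a \<times> 'a \<Rightarrow> 'a \<times> 'a \<times> 'a"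
  where "id_times r = (\<lambda>(x, y, z). (x, r (y, z)))"

definition yang_baxter_solution :: "'a set \<Rightarrow> ('a \<times> 'a \<Rightarrow> 'a \<times> 'a) \<Rightarrow> bool"
  where "yang_baxter_solution Y r \<longleftrightarrow>
    r \<in> Y \<times> Y \<rightarrow> Y \<times> Y \<and>
    (\<forall>t \<in> Y \<times> Y \<times> Y.
      (times_id r \<circ> id_times r \<circ> times_id r) t = (id_times r \<circ> times_id r \<circ> id_times r) t)"


section \<open>Internal semidirect products\<close>

text \<open>The external semidirect product \<open>H \<rtimes> S\<close> for the conjugation action of \<open>S\<close> on \<open>H\<close>
  inside \<open>G\<close>.\<close>

definition conj_semidirect ::
  "('a, 'm) monoid_scheme \<Rightarrow> 'a set \<Rightarrow> 'a set \<Rightarrow> ('a \<times> 'a) monoid"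
  where "conj_semidirect G H S =
    \<lparr>carrier = H \<times> S,
     monoid.mult = (\<lambda>(h1, s1) (h2, s2).
       (h1 \<otimes>\<^bsub>G\<^esub> (s1 \<otimes>\<^bsub>G\<^esub> h2 \<otimes>\<^bsub>G\<^esub> inv\<^bsub>G\<^esub> s1), s1 \<otimes>\<^bsub>G\<^esub> s2)),
     one = (\<one>\<^bsub>G\<^esub>, \<one>\<^bsub>G\<^esub>)\<rparr>"

end

theory Submission
  imports Defs
begin

text \<open>
  Everything follows from the internal semidirect decomposition \<open>G = HS\<close>, where \<open>H\<close> is normal
  and meets \<open>S\<close> trivially. Such a decomposition is the same as an idempotent endomorphism \<open>p\<close> of
  \<open>G\<close>, with kernel \<open>H\<close> and image \<open>S\<close> (\<open>complement_retraction\<close>). Since \<open>p (h \<otimes> s) = s\<close>, the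
  \<open>H\<close>-component of \<open>y\<close> is \<open>y \<otimes> inv (p y)\<close>, and the formula reads
  \<open>r (x, y) = (l x y, inv (l x y) \<otimes> x \<otimes> y)\<close>, where \<open>l x y\<close> is the conjugate
  \<open>p x \<otimes> (y \<otimes> inv (p y)) \<otimes> inv (p x)\<close> of that component by \<open>p x\<close>.

  Three properties give the braid relation on a triple \<open>(x, y, z)\<close>
  (\<open>yang_baxter_idempotent_endomorphism\<close>). First, \<open>r\<close> preserves products, so the third components
  of the two sides agree as soon as the first two do. Second, \<open>l x\<close> depends only on \<open>p x\<close>, and
  \<open>l x (l y z) = l (x \<otimes> y) z\<close>: the values of \<open>l\<close> lie in the kernel of \<open>p\<close>, because \<open>p\<close> is
  idempotent, and on this kernel \<open>l x\<close> is conjugation by \<open>p x\<close>. Hence both first components are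
  \<open>l (x \<otimes> y) z\<close>. Third, conjugation respects products; with \<open>c = l (x \<otimes> y) z\<close>, both
  second components are therefore \<open>inv c \<otimes> l x y \<otimes> c\<close>.
\<close>

context group
begin

text \<open>Together with associativity and \<open>inv_mult_group\<close>, these two cancellation laws let the
  simplifier compute normal forms of words in a free group.\<close>

lemma inv_cancel_left:
  assumes "x \<in> carrier G" "y \<in> carrier G"
  shows "x \<otimes> (inv x \<otimes> y) = y" and "inv x \<otimes> (x \<otimes> y) = y"
  using assms by (simp_all add: m_assoc[symmetric])

text \<open>The value of \<open>p\<close> at \<open>g = h \<otimes> s\<close> is \<open>s\<close>. Normality of \<open>H\<close> makes this a homomorphism, as
  \<open>h1 \<otimes> s1 \<otimes> h2 \<otimes> s2 = (h1 \<otimes> (s1 \<otimes> h2 \<otimes> inv s1)) \<otimes> (s1 \<otimes> s2)\<close>.\<close>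

lemma complement_retraction:
  assumes "H \<lhd> G" and "subgroup S G"
    and HS: "H <#> S = carrier G" and triv: "H \<inter> S = {\<one>}"
  obtains p where "p \<in> hom G G" and "\<And>h s. \<lbrakk>h \<in> H; s \<in> S\<rbrakk> \<Longrightarrow> p (h \<otimes> s) = s"
proof -
  interpret H: normal H G by fact
  interpret S: subgroup S G by fact
  define p where "p g = (THE s. s \<in> S \<and> g \<otimes> inv s \<in> H)" for g
  have p_eq: "p (h \<otimes> s) = s" if hs: "h \<in> H" "s \<in> S" for h s
    unfolding p_def
  proof (rule the_equality)
    show "s \<in> S \<and> h \<otimes> s \<otimes> inv s \<in> H" using hs by (simp add: m_assoc)
  next
    fix t assume t: "t \<in> S \<and> h \<otimes> s \<otimes> inv t \<in> H"
    have "s \<otimes> inv t = inv h \<otimes> (h \<otimes> s \<otimes> inv t)"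
      using hs t by (simp add: m_assoc inv_cancel_left)
    also have "\<dots> \<in> H" using hs t by simp
    finally have "s \<otimes> inv t \<in> H \<inter> S" using hs t by simp
    hence "s \<otimes> inv t = \<one>" using triv by blast
    thus "t = s" using hs t by (metis S.mem_carrier inv_closed inv_equality inv_inv)
  qed
  have "p \<in> hom G G"
  proof (rule homI)
    fix x assume "x \<in> carrier G"
    then obtain h s where "h \<in> H" "s \<in> S" "x = h \<otimes> s"
      unfolding HS[symmetric] set_mult_def by blast
    thus "p x \<in> carrier G" by (simp add: p_eq)
  next
    fix x y assume "x \<in> carrier G" "y \<in> carrier G"
    then obtain h s k t where hs: "h \<in> H" "s \<in> S" "x = h \<otimes> s"
      and kt: "k \<in> H" "t \<in> S" "y = k \<otimes> t"
      unfolding HS[symmetric] set_mult_def by blast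
    have "x \<otimes> y = (h \<otimes> (s \<otimes> k \<otimes> inv s)) \<otimes> (s \<otimes> t)"
      using hs kt by (simp add: m_assoc inv_cancel_left)
    moreover have "h \<otimes> (s \<otimes> k \<otimes> inv s) \<in> H"
      using hs kt H.inv_op_closed2 by simp
    ultimately show "p (x \<otimes> y) = p x \<otimes> p y"
      using hs kt p_eq by simp
  qed
  with p_eq that show thesis by blast
qed

text \<open>In the proof, \<open>l\<close> and \<open>q\<close> are the two components of the solution. The facts \<open>first\<close>,
  \<open>second\<close> and \<open>third\<close> compare the components of the two sides of the braid relation. All the
  computations rest on \<open>p (l x y) = \<one>\<close> and \<open>p (q x y) = p x \<otimes> p y\<close>.\<close>

lemma yang_baxter_idempotent_endomorphism:
  assumes p: "p \<in> hom G G" and idem: "\<And>x. x \<in> carrier G \<Longrightarrow> p (p x) = p x"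
  shows "yang_baxter_solution (carrier G)
    (\<lambda>(x, y). (p x \<otimes> (y \<otimes> inv (p y)) \<otimes> inv (p x),
      inv (p x \<otimes> (y \<otimes> inv (p y)) \<otimes> inv (p x)) \<otimes> x \<otimes> y))"
proof -
  interpret p: group_hom G G p
    using p by unfold_locales
  define l where "l x y = p x \<otimes> (y \<otimes> inv (p y)) \<otimes> inv (p x)" for x y
  define q where "q x y = inv (l x y) \<otimes> x \<otimes> y" for x y
  have l_cl [simp]: "l x y \<in> carrier G" if "x \<in> carrier G" "y \<in> carrier G" for x y
    using that by (simp add: l_def)
  have q_cl [simp]: "q x y \<in> carrier G" if "x \<in> carrier G" "y \<in> carrier G" for x y
    using that by (simp add: q_def)
  have p_l: "p (l x y) = \<one>" if "x \<in> carrier G" "y \<in> carrier G" for x y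
    using that by (simp add: l_def idem)
  have p_q: "p (q x y) = p x \<otimes> p y" if "x \<in> carrier G" "y \<in> carrier G" for x y
    using that by (simp add: q_def p_l)
  have prod: "l x y \<otimes> q x y = x \<otimes> y" if "x \<in> carrier G" "y \<in> carrier G" for x y
    using that by (simp add: q_def m_assoc inv_cancel_left)
  have first: "l (l x y) (l (q x y) z) = l x (l y z)"
    if "x \<in> carrier G" "y \<in> carrier G" "z \<in> carrier G" for x y z
  proof -
    have "l (l x y) (l (q x y) z) = l (q x y) z"
      using that by (simp add: l_def [of "l x y"] p_l)
    also have "\<dots> = p x \<otimes> l y z \<otimes> inv (p x)"
      using that by (simp add: l_def p_q m_assoc inv_mult_group)
    also have "\<dots> = l x (l y z)"
      using that by (simp add: l_def [of x "l y z"] p_l)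
    finally show ?thesis .
  qed
  have second: "q (l x y) (l (q x y) z) = l (q x (l y z)) (q y z)"
    if xyz: "x \<in> carrier G" "y \<in> carrier G" "z \<in> carrier G" for x y z
  proof -
    \<comment> \<open>The kernel component of \<open>q y z\<close> is that of \<open>y\<close>, conjugated by an element of the kernel.
      Conjugating by \<open>p x\<close> turns it into a product of values of \<open>l\<close>.\<close>
    have kernel_part: "q y z \<otimes> inv (p (q y z)) = inv (l y z) \<otimes> (y \<otimes> inv (p y)) \<otimes> l y z"
      using xyz by (simp only: p_q) (simp add: q_def l_def m_assoc inv_mult_group inv_cancel_left)
    have conj: "p x \<otimes> l y z \<otimes> inv (p x) = l (q x y) z"
      using xyz by (simp add: l_def p_q m_assoc inv_mult_group)
    have "l (q x (l y z)) (q y z) = p x \<otimes> (q y z \<otimes> inv (p (q y z))) \<otimes> inv (p x)"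
      using xyz by (simp add: l_def [of "q x (l y z)"] p_q p_l)
    also have "\<dots> = inv (p x \<otimes> l y z \<otimes> inv (p x)) \<otimes> l x y \<otimes> (p x \<otimes> l y z \<otimes> inv (p x))"
      using xyz unfolding kernel_part
      by (simp add: l_def [of x y] m_assoc inv_mult_group inv_cancel_left)
    also have "\<dots> = inv (l (q x y) z) \<otimes> l x y \<otimes> l (q x y) z"
      by (simp only: conj)
    also have "\<dots> = q (l x y) (l (q x y) z)"
      using xyz by (simp add: q_def [of "l x y"] l_def [of "l x y"] p_l)
    finally show ?thesis by simp
  qed
  have third: "q (q x y) z = q (q x (l y z)) (q y z)"
    if xyz: "x \<in> carrier G" "y \<in> carrier G" "z \<in> carrier G" for x y z
  proof -
    \<comment> \<open>Each side of the braid relation is a triple with product \<open>x \<otimes> y \<otimes> z\<close>, so the equal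
      first two components can be cancelled.\<close>
    let ?a = "l (l x y) (l (q x y) z)" and ?b = "q (l x y) (l (q x y) z)"
    let ?c = "l x (l y z)" and ?d = "l (q x (l y z)) (q y z)"
    have "?a \<otimes> ?b \<otimes> q (q x y) z = l x y \<otimes> (l (q x y) z \<otimes> q (q x y) z)"
      using xyz by (simp add: prod[of "l x y" "l (q x y) z"] m_assoc)
    also have "\<dots> = (l x y \<otimes> q x y) \<otimes> z"
      using xyz by (simp only: prod[of "q x y" z] q_cl) (simp add: m_assoc)
    also have "\<dots> = x \<otimes> y \<otimes> z"
      using xyz by (simp add: prod)
    also have "\<dots> = x \<otimes> (l y z \<otimes> q y z)"
      using xyz by (simp add: prod m_assoc)
    also have "\<dots> = ?c \<otimes> q x (l y z) \<otimes> q y z"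
      using xyz by (simp add: prod[of x "l y z"] m_assoc[symmetric])
    also have "\<dots> = ?c \<otimes> ?d \<otimes> q (q x (l y z)) (q y z)"
      using xyz by (simp add: prod[of "q x (l y z)" "q y z"] m_assoc)
    finally show ?thesis
      using xyz by (simp add: first second)
  qed
  have "yang_baxter_solution (carrier G) (\<lambda>(x, y). (l x y, q x y))"
    unfolding yang_baxter_solution_def times_id_def id_times_def
    \<comment> \<open>As a rewrite rule, \<open>third\<close> loops from left to right: its right-hand side is an instance
      of its left-hand side.\<close>
    by (auto simp: first second third[symmetric])
  thus ?thesis by (simp only: l_def q_def)
qed

text \<open>The \<open>H\<close>-component of \<open>x \<otimes> y\<close> is
  \<open>(x \<otimes> inv (p x)) \<otimes> (p x \<otimes> (y \<otimes> inv (p y)) \<otimes> inv (p x))\<close>, which is the twisted product of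
  the \<open>H\<close>-components of \<open>x\<close> and \<open>y\<close> in the semidirect product.\<close>

lemma iso_conj_semidirect:
  assumes "H \<lhd> G" and "subgroup S G" and HS: "H <#> S = carrier G"
    and p: "p \<in> hom G G" and p_eq: "\<And>h s. \<lbrakk>h \<in> H; s \<in> S\<rbrakk> \<Longrightarrow> p (h \<otimes> s) = s"
  shows "(\<lambda>g. (g \<otimes> inv (p g), p g)) \<in> iso G (conj_semidirect G H S)"
proof -
  interpret H: normal H G by fact
  interpret S: subgroup S G by fact
  let ?f = "\<lambda>g. (g \<otimes> inv (p g), p g)"
  have f_eq: "?f (h \<otimes> s) = (h, s)" if "h \<in> H" "s \<in> S" for h s
    using that by (simp add: p_eq m_assoc)
  have f_cl: "?f g \<in> H \<times> S" and f_inv: "fst (?f g) \<otimes> snd (?f g) = g"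
    if g: "g \<in> carrier G" for g
  proof -
    obtain h s where hs: "h \<in> H" "s \<in> S" "g = h \<otimes> s"
      using g unfolding HS[symmetric] set_mult_def by blast
    hence "?f g = (h, s)" using f_eq by blast
    thus "?f g \<in> H \<times> S" and "fst (?f g) \<otimes> snd (?f g) = g"
      using hs by (simp_all add: m_assoc)
  qed
  interpret p: group_hom G G p
    using p by unfold_locales
  have "bij_betw ?f (carrier G) (H \<times> S)"
    by (rule bij_betw_byWitness[where f' = "\<lambda>(h, s). h \<otimes> s"])
      (use f_eq f_cl f_inv in \<open>auto simp: m_assoc\<close>)
  moreover have "?f \<in> hom G (conj_semidirect G H S)"
    using f_cl
    by (auto simp: hom_def conj_semidirect_def m_assoc inv_mult_group inv_cancel_left)
  ultimately show ?thesis
    by (simp add: iso_def conj_semidirect_def)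
qed

text \<open>The map \<open>p\<close> fixes \<open>S\<close>, since \<open>s = \<one> \<otimes> s\<close>, and has its values in \<open>S\<close>, so it is idempotent.
  Evaluating the resulting solution at \<open>h1 \<otimes> s1\<close> and \<open>h2 \<otimes> s2\<close> gives the formula in
  components.\<close>

lemma yang_baxter_semidirect:
  assumes "H \<lhd> G" and "subgroup S G" and HS: "H <#> S = carrier G"
    and p: "p \<in> hom G G" and p_eq: "\<And>h s. \<lbrakk>h \<in> H; s \<in> S\<rbrakk> \<Longrightarrow> p (h \<otimes> s) = s"
  shows "\<exists>r. yang_baxter_solution (carrier G) r \<and>
      (\<forall>h1\<in>H. \<forall>h2\<in>H. \<forall>s1\<in>S. \<forall>s2\<in>S.
        r (h1 \<otimes> s1, h2 \<otimes> s2) =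
          (s1 \<otimes> h2 \<otimes> inv s1,
           s1 \<otimes> inv h2 \<otimes> inv s1 \<otimes> h1 \<otimes> s1 \<otimes> h2 \<otimes> s2))"
proof -
  interpret H: normal H G by fact
  interpret S: subgroup S G by fact
  have idem: "p (p x) = p x" if g: "x \<in> carrier G" for x
  proof -
    obtain h s where x: "h \<in> H" "s \<in> S" "x = h \<otimes> s"
      using g unfolding HS[symmetric] set_mult_def by blast
    have "p s = s" using p_eq[OF H.one_closed x(2)] x(2) by simp
    thus ?thesis using x by (simp only: p_eq)
  qed
  let ?r = "\<lambda>(x, y). (p x \<otimes> (y \<otimes> inv (p y)) \<otimes> inv (p x),
      inv (p x \<otimes> (y \<otimes> inv (p y)) \<otimes> inv (p x)) \<otimes> x \<otimes> y)"
  show ?thesis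
  proof (intro exI[of _ ?r] conjI ballI)
    show "yang_baxter_solution (carrier G) ?r"
      using p idem by (rule yang_baxter_idempotent_endomorphism)
  next
    fix h1 h2 s1 s2 assume hs: "h1 \<in> H" "h2 \<in> H" "s1 \<in> S" "s2 \<in> S"
    have "h2 \<otimes> s2 \<otimes> inv s2 = h2"
      using hs by (simp add: m_assoc)
    moreover have "inv (s1 \<otimes> h2 \<otimes> inv s1) \<otimes> (h1 \<otimes> s1) \<otimes> (h2 \<otimes> s2) =
        s1 \<otimes> inv h2 \<otimes> inv s1 \<otimes> h1 \<otimes> s1 \<otimes> h2 \<otimes> s2"
      using hs by (simp add: m_assoc inv_mult_group)
    ultimately show "?r (h1 \<otimes> s1, h2 \<otimes> s2) =
        (s1 \<otimes> h2 \<otimes> inv s1, s1 \<otimes> inv h2 \<otimes> inv s1 \<otimes> h1 \<otimes> s1 \<otimes> h2 \<otimes> s2)"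
      by (simp only: split p_eq hs)
  qed
qed

end

theorem corollary6p2:
  fixes G :: "('a, 'm) monoid_scheme" (structure)
    and N :: "('b, 'n) monoid_scheme"
    and act :: "'a \<Rightarrow> 'b \<Rightarrow> 'b"
    and H S :: "'a set"
  assumes "skew_bracoid G N act"
    and "is_complement G H (bracoid_stab G N act)"
    and "almost_classical G (complement_group N act H) (complement_act N act H) H"
    and "S = bracoid_stab G (complement_group N act H) (complement_act N act H)"
  shows "carrier G = H <#> S \<and> G \<cong> conj_semidirect G H S \<and>
    (\<exists>r. yang_baxter_solution (carrier G) r \<and>
      (\<forall>h1\<in>H. \<forall>h2\<in>H. \<forall>s1\<in>S. \<forall>s2\<in>S.
        r (h1 \<otimes> s1, h2 \<otimes> s2) =
          (s1 \<otimes> h2 \<otimes> inv s1,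
           s1 \<otimes> inv h2 \<otimes> inv s1 \<otimes> h1 \<otimes> s1 \<otimes> h2 \<otimes> s2)))"
proof -
  interpret A: almost_classical G "complement_group N act H" "complement_act N act H" H
    by fact
  have S: "subgroup S G"
    unfolding assms(4) by (rule A.stabilizer_subgroup) simp
  have HS: "H <#> S = carrier G" and triv: "H \<inter> S = {\<one>}"
    using A.complement by (simp_all add: is_complement_def assms(4))
  have H: "H \<lhd> G" by (rule A.normal_axioms)
  obtain p where p: "p \<in> hom G G" and p_eq: "\<And>h s. \<lbrakk>h \<in> H; s \<in> S\<rbrakk> \<Longrightarrow> p (h \<otimes> s) = s"
    by (rule A.complement_retraction[OF H S HS triv]) blast
  have "G \<cong> conj_semidirect G H S"
    using A.iso_conj_semidirect[OF H S HS p p_eq] unfolding is_iso_def by blast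
  with HS A.yang_baxter_semidirect[OF H S HS p p_eq] show ?thesis
    by (intro conjI) (rule sym)
qed

end
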